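(* Assume that $T$ is continuous on $C$, that $S_*\neq\varnothing$ and that $S_*\subseteq S_{\rm dual}$. Let $(x^k)_{k\in\mathbb{N}}$ be an infinite sequence generated by Conceptual Algorithm B with Variant B.3, that is, $x^{k+1}=P_{C\cap H(z^k,\bar v^k)\cap W(x^k)}(x^0)$, such that $x^k\notin S_*$ for all $k\in\mathbb{N}$. Then $(x^k)_{k\in\mathbb{N}}$ converges to $\overline{x}=P_{S_*}(x^0)$.
   Context: $\mathbb{R}^n$ carries the Euclidean inner product $\langle\cdot,\cdot\rangle$ and norm $\|\cdot\|$; $\mathbb{N}=\{0,1,2,\dots\}$. $T:\operatorname{dom}(T)\subseteq\mathbb{R}^n\to\mathbb{R}^n$ is an operator and $C\subseteq\operatorname{dom}(T)$ is nonempty, closed and convex. $P_S$ is the orthogonal projection onto a nonempty closed convex set $S$ (under the hypotheses of the claim, $S_*$ is closed and convex). For $x\in C$, $\mathcal{N}_C(x)=\{u\in\mathbb{R}^n:\langle u,y-x\rangle\le 0\ \forall y\in C\}$. $S_*=\{x_*\in C:\langle T(x_* ),x-x_*\rangle\ge0\ \forall x\in C\}$ and $S_{\rm dual}=\{x_*\in C:\langle T(x),x-x_*\rangle\ge0\ \forall x\in C\}$. For $z\in C$ and $v\in\mathcal{N}_C(z)$, $H(z,v)=\{y\in\mathbb{R}^n:\langle T(z)+v,y-z\rangle\le0\}$. With $x^0$ the starting point, $W(x)=\{y\in\mathbb{R}^n:\langle y-x,x^0-x\rangle\le0\}$. Conceptual Algorithm B. Fix $\sigma>0$, $\delta,\theta\in(0,1)$,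 $M>0$. Linesearch B, for input $x\in C$, $u\in\mathcal{N}_C(x)$: start with $\alpha=\sigma$. For each trial $\alpha$ let $z_\alpha=P_C(x-\alpha(T(x)+\alpha u))$ and choose any $v_\alpha\in\mathcal{N}_C(z_\alpha)$ with $\|v_\alpha\|\le M$. While $\alpha\|T(z_\alpha)-T(x)+\alpha v_\alpha-\alpha u\|>\delta\|z_\alpha-x\|$, replace $\alpha$ by $\theta\alpha$ (and choose a new such $v_\alpha$). Output $(\alpha,z_\alpha,v_\alpha)$. Algorithm: take $x^0\in C$. At iteration $k$, stop if $x^k=P_C(x^k-T(x^k))$. Otherwise choose any $u^k\in\mathcal{N}_C(x^k)$ with $\|u^k\|\le M$, let $(\alpha_k,z^k,v^k)$ be the output of Linesearch B for input $(x^k,u^k)$, set $\bar v^k=\alpha_kv^k$, and compute $x^{k+1}$ by the update rule of the chosen variant. *)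

theory Defs
  imports "HOL-Analysis.Analysis"
begin

text \<open>
  The orthogonal projection onto a nonempty closed convex set \<open>S\<close> is the library's
  \<open>closest_point S\<close>. An operator is a total function \<open>T\<close>. The definitions below use its
  values at points of the feasible set \<open>C\<close> only: the iterates and the linesearch points all
  belong to \<open>C\<close>.
\<close>

definition normal_cone :: "'a::euclidean_space set \<Rightarrow> 'a \<Rightarrow> 'a set" where
  "normal_cone C x = {u. \<forall>y\<in>C. u \<bullet> (y - x) \<le> 0}"

definition vi_solutions :: "('a::euclidean_space \<Rightarrow> 'a) \<Rightarrow> 'a set \<Rightarrow> 'a set" where
  "vi_solutions T C = {xs \<in> C. \<forall>x\<in>C. T xs \<bullet> (x - xs) \<ge> 0}"

definition dual_vi_solutions :: "('a::euclidean_space \<Rightarrow> 'a) \<Rightarrow> 'a set \<Rightarrow> 'a set" where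
  "dual_vi_solutions T C = {xs \<in> C. \<forall>x\<in>C. T x \<bullet> (x - xs) \<ge> 0}"

definition H_set :: "('a::euclidean_space \<Rightarrow> 'a) \<Rightarrow> 'a \<Rightarrow> 'a \<Rightarrow> 'a set" where
  "H_set T z v = {y. (T z + v) \<bullet> (y - z) \<le> 0}"

definition W_set :: "'a::euclidean_space \<Rightarrow> 'a \<Rightarrow> 'a set" where
  "W_set x0 x = {y. (y - x) \<bullet> (x0 - x) \<le> 0}"

definition trial_point ::
  "('a::euclidean_space \<Rightarrow> 'a) \<Rightarrow> 'a set \<Rightarrow> 'a \<Rightarrow> 'a \<Rightarrow> real \<Rightarrow> 'a" where
  "trial_point T C x u a = closest_point C (x - a *\<^sub>R (T x + a *\<^sub>R u))"

text \<open>
  \<open>linesearch_B T C \<delta> \<theta> M x u a a' z v\<close>: with input \<open>(x, u)\<close> and current trial value \<open>a\<close>,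
  the loop of Linesearch B can terminate with output \<open>(a', z, v)\<close>. The vector \<open>w\<close> is the
  choice made for the current trial; rejecting a trial requires the test to fail for the
  vector actually chosen, and a fresh choice is made for the next trial.
\<close>

inductive linesearch_B ::
  "('a::euclidean_space \<Rightarrow> 'a) \<Rightarrow> 'a set \<Rightarrow> real \<Rightarrow> real \<Rightarrow> real \<Rightarrow> 'a \<Rightarrow> 'a \<Rightarrow>
    real \<Rightarrow> real \<Rightarrow> 'a \<Rightarrow> 'a \<Rightarrow> bool"
  for T C \<delta> \<theta> M x u
where
  accept:
    "\<lbrakk>z = trial_point T C x u a; w \<in> normal_cone C z; norm w \<le> M;
      a * norm (T z - T x + a *\<^sub>R w - a *\<^sub>R u) \<le> \<delta> * norm (z - x)\<rbrakk>
     \<Longrightarrow> linesearch_B T C \<delta> \<theta> M x u a a z w"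
| reject:
    "\<lbrakk>z = trial_point T C x u a; w \<in> normal_cone C z; norm w \<le> M;
      a * norm (T z - T x + a *\<^sub>R w - a *\<^sub>R u) > \<delta> * norm (z - x);
      linesearch_B T C \<delta> \<theta> M x u (\<theta> * a) a' z' v\<rbrakk>
     \<Longrightarrow> linesearch_B T C \<delta> \<theta> M x u a a' z' v"

text \<open>
  An infinite sequence generated by Conceptual Algorithm B: the stopping test fails at every
  iteration. The parameter \<open>upd\<close> is the update rule of the variant; it receives \<open>x\<^sup>0\<close>,
  \<open>x\<^sup>k\<close>, \<open>z\<^sup>k\<close> and the scaled vector \<open>\<alpha>\<^sub>k v\<^sup>k\<close>.
\<close>

definition generated_by_B ::
  "('a::euclidean_space \<Rightarrow> 'a) \<Rightarrow> 'a set \<Rightarrow> real \<Rightarrow> real \<Rightarrow> real \<Rightarrow> real \<Rightarrow>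
    ('a \<Rightarrow> 'a \<Rightarrow> 'a \<Rightarrow> 'a \<Rightarrow> 'a) \<Rightarrow> (nat \<Rightarrow> 'a) \<Rightarrow> bool" where
  "generated_by_B T C \<sigma> \<delta> \<theta> M upd x \<longleftrightarrow>
     x 0 \<in> C \<and>
     (\<forall>k. x k \<noteq> closest_point C (x k - T (x k)) \<and>
       (\<exists>u \<alpha> z v. u \<in> normal_cone C (x k) \<and> norm u \<le> M \<and>
          linesearch_B T C \<delta> \<theta> M (x k) u \<sigma> \<alpha> z v \<and>
          x (Suc k) = upd (x 0) (x k) z (\<alpha> *\<^sub>R v)))"

definition variant_B3 ::
  "('a::euclidean_space \<Rightarrow> 'a) \<Rightarrow> 'a set \<Rightarrow> 'a \<Rightarrow> 'a \<Rightarrow> 'a \<Rightarrow> 'a \<Rightarrow> 'a" where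
  "variant_B3 T C x0 x z vbar = closest_point (C \<inter> H_set T z vbar \<inter> W_set x0 x) x0"

end

theory Submission
  imports Defs
begin

text \<open>
  The solution set \<open>S\<close> stays inside all the sets projected upon, so the distances
  \<open>\<parallel>x\<^sup>k - x\<^sup>0\<parallel>\<close> are bounded by that of the projection \<open>p\<close> of \<open>x\<^sup>0\<close> onto \<open>S\<close>. They also
  increase by an amount controlling \<open>\<parallel>x\<^sup>k\<^sup>+\<^sup>1 - x\<^sup>k\<parallel>\<close>, hence consecutive iterates merge. As
  \<open>x\<^sup>k\<^sup>+\<^sup>1\<close> lies in the halfspace \<open>H\<close> and the linesearch separates \<open>x\<^sup>k\<close> from it, also
  \<open>x\<^sup>k - z\<^sup>k \<rightarrow> 0\<close>, which forces cluster points to be solutions. A solution no farther from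
  \<open>x\<^sup>0\<close> than \<open>p\<close> is \<open>p\<close> itself.
\<close>

section \<open>Convergence through subsequences\<close>

text \<open>Otherwise a subsequence stays at distance at least some \<open>e > 0\<close> from
  \<open>p\<close>; by compactness a further subsequence converges, and its limit would have to be
  \<open>p\<close>.\<close>

lemma tendsto_of_unique_subseq_limit:
  fixes x :: "nat \<Rightarrow> 'a::metric_space"
  assumes K: "compact K" and x: "\<And>k. x k \<in> K"
    and unique: "\<And>r l. strict_mono r \<Longrightarrow> (x \<circ> r) \<longlonglongrightarrow> l \<Longrightarrow> l = p"
  shows "x \<longlonglongrightarrow> p"
proof (rule ccontr)
  assume "\<not> x \<longlonglongrightarrow> p"
  then obtain e where e: "e > 0" and far: "\<And>n. \<exists>k\<ge>n. dist (x k) p \<ge> e"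
    unfolding lim_sequentially by (meson not_less)
  have "infinite {k. dist (x k) p \<ge> e}"
    unfolding infinite_nat_iff_unbounded_le using far by blast
  then obtain r :: "nat \<Rightarrow> nat" where r: "strict_mono r" "\<And>n. dist (x (r n)) p \<ge> e"
    using infinite_enumerate by blast
  obtain l q where q: "strict_mono q" "((x \<circ> r) \<circ> q) \<longlonglongrightarrow> l"
    using K x unfolding compact_def by (metis comp_apply)
  have "l = p"
    using unique[of "r \<circ> q" l] r(1) q by (simp add: strict_mono_o comp_assoc)
  with q(2) e obtain n where "dist (((x \<circ> r) \<circ> q) n) p < e"
    unfolding lim_sequentially by blast
  with r(2)[of "q n"] show False by simp
qed

section \<open>Output of the linesearch\<close>

text \<open>Induction over the loop. The last clause keeps the rejected trial
  \<open>a' / \<theta>\<close> just before the accepted one; its failed test is what helps when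
  \<open>a'\<close> is tiny.\<close>

lemma linesearch_B_output:
  assumes "linesearch_B T C \<delta> \<theta> M x u a a' z v" and "0 < a" and "0 < \<theta>" and "\<theta> < 1"
  shows "0 < a'" and "a' \<le> a" and "z = trial_point T C x u a'"
    and "v \<in> normal_cone C z" and "norm v \<le> M"
    and "a' * norm (T z - T x + a' *\<^sub>R v - a' *\<^sub>R u) \<le> \<delta> * norm (z - x)"
    and "a' = a \<or> a' / \<theta> \<le> a \<and>
      (\<exists>y w. y = trial_point T C x u (a' / \<theta>) \<and> norm w \<le> M \<and>
        \<delta> * norm (y - x) < a' / \<theta> * norm (T y - T x + (a' / \<theta>) *\<^sub>R w - (a' / \<theta>) *\<^sub>R u))"
proof -
  have "0 < a' \<and> a' \<le> a \<and> z = trial_point T C x u a' \<and> v \<in> normal_cone C z \<and> norm v \<le> M \<and>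
    a' * norm (T z - T x + a' *\<^sub>R v - a' *\<^sub>R u) \<le> \<delta> * norm (z - x) \<and>
    (a' = a \<or> a' / \<theta> \<le> a \<and>
      (\<exists>y w. y = trial_point T C x u (a' / \<theta>) \<and> norm w \<le> M \<and>
        \<delta> * norm (y - x) < a' / \<theta> * norm (T y - T x + (a' / \<theta>) *\<^sub>R w - (a' / \<theta>) *\<^sub>R u)))"
    using assms(1,2)
  proof (induction rule: linesearch_B.induct)
    case (accept z a w)
    then show ?case by simp
  next
    case (reject y a w a' z v)
    have pos: "0 < \<theta> * a" using reject.prems \<open>0 < \<theta>\<close> by simp
    note IH = reject.IH[OF pos]
    have le: "\<theta> * a \<le> a" using reject.prems \<open>\<theta> < 1\<close> by simp
    show ?case
    \<comment> \<open>If \<open>a'\<close> equals \<open>\<theta> * a\<close>, the trial rejected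
      here is the predecessor; otherwise the induction hypothesis provides it, and
      \<open>\<theta> * a \<le> a\<close> relaxes its bound.\<close>
    proof (cases "a' = \<theta> * a")
      case True
      then have "a' / \<theta> = a" using \<open>0 < \<theta>\<close> by simp
      then show ?thesis using IH reject.hyps le by auto
    next
      case False
      then show ?thesis using IH le by auto
    qed
  qed
  then show "0 < a'" and "a' \<le> a" and "z = trial_point T C x u a'"
    and "v \<in> normal_cone C z" and "norm v \<le> M"
    and "a' * norm (T z - T x + a' *\<^sub>R v - a' *\<^sub>R u) \<le> \<delta> * norm (z - x)"
    and "a' = a \<or> a' / \<theta> \<le> a \<and>
      (\<exists>y w. y = trial_point T C x u (a' / \<theta>) \<and> norm w \<le> M \<and>
        \<delta> * norm (y - x) < a' / \<theta> * norm (T y - T x + (a' / \<theta>) *\<^sub>R w - (a' / \<theta>) *\<^sub>R u))"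
    by blast+
qed

section \<open>Halfspaces and the dual solution set\<close>

lemma closed_convex_H_set: "closed (H_set T z v)" "convex (H_set T z v)"
proof -
  have "H_set T z v = {y. (T z + v) \<bullet> y \<le> (T z + v) \<bullet> z}"
    by (auto simp: H_set_def inner_diff_right)
  then show "closed (H_set T z v)" "convex (H_set T z v)"
    by (simp_all add: closed_halfspace_le convex_halfspace_le)
qed

lemma closed_convex_W_set: "closed (W_set x0 x)" "convex (W_set x0 x)"
proof -
  have "W_set x0 x = {y. (x0 - x) \<bullet> y \<le> (x0 - x) \<bullet> x}"
    by (auto simp: W_set_def inner_diff_left inner_diff_right inner_commute)
  then show "closed (W_set x0 x)" "convex (W_set x0 x)"
    by (simp_all add: closed_halfspace_le convex_halfspace_le)
qed

text \<open>For fixed \<open>x\<close> the dual inequality is affine in the candidate solution, so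
  the set is \<open>C\<close> cut by halfspaces.\<close>

lemma closed_convex_dual_vi_solutions:
  assumes "closed C" "convex C"
  shows "closed (dual_vi_solutions T C)" "convex (dual_vi_solutions T C)"
proof -
  have eq: "dual_vi_solutions T C = C \<inter> (\<Inter>x\<in>C. {y. T x \<bullet> y \<le> T x \<bullet> x})"
    by (auto simp: dual_vi_solutions_def inner_diff_right)
  show "closed (dual_vi_solutions T C)" unfolding eq
    by (intro closed_Int closed_INT ballI assms closed_halfspace_le)
  show "convex (dual_vi_solutions T C)" unfolding eq
    by (intro convex_Int convex_INT assms convex_halfspace_le)
qed

text \<open>Minty's lemma; this direction needs no monotonicity.\<close>
lemma dual_vi_solutions_subset:
  assumes "convex C" "continuous_on C T"
  shows "dual_vi_solutions T C \<subseteq> vi_solutions T C"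
proof
  fix s assume s: "s \<in> dual_vi_solutions T C"
  then have sC: "s \<in> C" by (simp add: dual_vi_solutions_def)
  have "T s \<bullet> (y - s) \<ge> 0" if y: "y \<in> C" for y
  proof -
    \<comment> \<open>Approach \<open>s\<close> along the segment towards \<open>y\<close>: the dual
      inequality at \<open>w n\<close> can be divided by \<open>t n > 0\<close> before passing to
      the limit.\<close>
    define t where "t n = inverse (real (Suc n))" for n
    define w where "w n = s + t n *\<^sub>R (y - s)" for n
    have t: "0 < t n" "t n \<le> 1" for n by (auto simp: t_def inverse_le_1_iff)
    have "w n = (1 - t n) *\<^sub>R s + t n *\<^sub>R y" for n
      by (simp add: w_def algebra_simps)
    then have wC: "w n \<in> C" for n
      using convexD_alt[OF assms(1) sC y, of "t n"] t[of n] by simp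
    have "t \<longlonglongrightarrow> 0" unfolding t_def by (rule LIMSEQ_inverse_real_of_nat)
    then have "w \<longlonglongrightarrow> s + 0 *\<^sub>R (y - s)" unfolding w_def by (intro tendsto_intros)
    then have "w \<longlonglongrightarrow> s" by simp
    from continuous_on_tendsto_compose[OF assms(2) this sC] wC
    have "(\<lambda>n. T (w n)) \<longlonglongrightarrow> T s" by simp
    then have "(\<lambda>n. T (w n) \<bullet> (y - s)) \<longlonglongrightarrow> T s \<bullet> (y - s)" by (intro tendsto_intros)
    moreover have "T (w n) \<bullet> (y - s) \<ge> 0" for n
    proof -
      have "0 \<le> T (w n) \<bullet> (w n - s)" using s wC by (simp add: dual_vi_solutions_def)
      then show ?thesis using t[of n] by (simp add: w_def zero_le_mult_iff)
    qed
    ultimately show ?thesis by (intro LIMSEQ_le_const) auto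
  qed
  with sC show "s \<in> vi_solutions T C" by (simp add: vi_solutions_def)
qed

section \<open>Geometry of trial points\<close>

lemma trial_point_in:
  assumes "closed C" "x \<in> C"
  shows "trial_point T C x u a \<in> C"
  using assms unfolding trial_point_def by (intro closest_point_in_set) auto

text \<open>The obtuse-angle inequality of the projection, rearranged.\<close>

lemma trial_point_dot:
  assumes "closed C" "convex C" "y \<in> C" and z: "z = trial_point T C x u a"
  shows "(x - z) \<bullet> (y - z) \<le> a * ((T x + a *\<^sub>R u) \<bullet> (y - z))"
proof -
  have "(x - a *\<^sub>R (T x + a *\<^sub>R u) - z) \<bullet> (y - z) \<le> 0"
    unfolding z trial_point_def by (rule closest_point_dot[OF assms(2,1,3)])
  moreover have "(x - a *\<^sub>R (T x + a *\<^sub>R u) - z) \<bullet> (y - z)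
      = (x - z) \<bullet> (y - z) - a * ((T x + a *\<^sub>R u) \<bullet> (y - z))"
    by (simp add: inner_simps algebra_simps)
  ultimately show ?thesis by linarith
qed

text \<open>The projection is nonexpansive and fixes \<open>x\<close>.\<close>

lemma trial_point_displacement:
  assumes "closed C" "convex C" "x \<in> C" "0 \<le> a"
  shows "norm (trial_point T C x u a - x) \<le> a * norm (T x + a *\<^sub>R u)"
proof -
  have "dist (closest_point C (x - a *\<^sub>R (T x + a *\<^sub>R u))) (closest_point C x)
      \<le> dist (x - a *\<^sub>R (T x + a *\<^sub>R u)) x"
    using assms by (intro closest_point_lipschitz) auto
  then show ?thesis
    using assms by (simp add: closest_point_self trial_point_def dist_norm)
qed

text \<open>The projection inequality at \<open>x\<close> itself bounds the squared displacement
  with \<open>T x + a *\<^sub>R u\<close>; by the acceptance test, passing to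
  \<open>T z + a *\<^sub>R v\<close> costs at most the fraction \<open>\<delta>\<close> of
  it.\<close>

lemma accepted_trial_separates:
  assumes "closed C" "convex C" "x \<in> C" "0 \<le> a" and z: "z = trial_point T C x u a"
    and acc: "a * norm (T z - T x + a *\<^sub>R v - a *\<^sub>R u) \<le> \<delta> * norm (z - x)"
  shows "(1 - \<delta>) * (norm (x - z))\<^sup>2 \<le> a * ((T z + a *\<^sub>R v) \<bullet> (x - z))"
proof -
  let ?d = "T z - T x + a *\<^sub>R v - a *\<^sub>R u"
  have "- (?d \<bullet> (x - z)) \<le> norm ?d * norm (x - z)"
    using norm_cauchy_schwarz[of "- ?d" "x - z"] by (metis inner_minus_left norm_minus_cancel)
  then have "a * (- (?d \<bullet> (x - z))) \<le> a * (norm ?d * norm (x - z))"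
    by (rule mult_left_mono) (use assms in simp)
  also have "\<dots> \<le> \<delta> * norm (z - x) * norm (x - z)"
    using mult_right_mono[OF acc, of "norm (x - z)"] by (simp add: mult.assoc)
  finally have 1: "- (a * (?d \<bullet> (x - z))) \<le> \<delta> * (norm (x - z))\<^sup>2"
    by (simp add: power2_eq_square norm_minus_commute mult.assoc)
  have 2: "(norm (x - z))\<^sup>2 \<le> a * ((T x + a *\<^sub>R u) \<bullet> (x - z))"
    using trial_point_dot[OF assms(1-3) z] by (simp add: dot_square_norm)
  have "(T z + a *\<^sub>R v) \<bullet> (x - z) = ?d \<bullet> (x - z) + (T x + a *\<^sub>R u) \<bullet> (x - z)"
    by (simp add: inner_simps)
  then show ?thesis using 1 2 by (simp add: algebra_simps)
qed

text \<open>
  A trial point whose displacement is small compared with the trial value certifies that \<open>x\<close>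
  almost solves the variational inequality. The bound is insensitive to whether the trial value
  itself tends to zero.
\<close>
lemma trial_point_near_solution:
  assumes "closed C" "convex C" "x \<in> C" "y \<in> C" "0 < a"
    and u: "u \<in> normal_cone C x" "norm u \<le> M"
    and z: "z = trial_point T C x u a" and e: "norm (x - z) \<le> e * a"
  shows "- (e * (norm (y - x) + a * e + a * norm (T x) + a * a * M)) \<le> T x \<bullet> (y - x)"
proof -
  have e0: "0 \<le> e" using e \<open>0 < a\<close> norm_ge_zero[of "x - z"]
    by (smt (verit) zero_le_mult_iff)
  have ny: "norm (y - z) \<le> norm (y - x) + e * a"
    using norm_triangle_ineq[of "y - x" "x - z"] e by simp
  have "- (norm (x - z) * norm (y - z)) \<le> (x - z) \<bullet> (y - z)"
    using Cauchy_Schwarz_ineq2[of "x - z" "y - z"] by linarith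
  also have "\<dots> \<le> a * ((T x + a *\<^sub>R u) \<bullet> (y - z))"
    by (rule trial_point_dot[OF assms(1,2,4) z])
  finally have "- (a * ((T x + a *\<^sub>R u) \<bullet> (y - z))) \<le> norm (x - z) * norm (y - z)" by simp
  also have "\<dots> \<le> (e * a) * (norm (y - x) + e * a)"
    using e ny e0 \<open>0 < a\<close> by (intro mult_mono) auto
  finally have "a * (- ((T x + a *\<^sub>R u) \<bullet> (y - z))) \<le> a * (e * (norm (y - x) + e * a))"
    by (simp add: algebra_simps)
  \<comment> \<open>The displacement bound is proportional to \<open>a\<close>, so a factor
    \<open>a\<close> cancels and no division by a small trial value remains.\<close>
  then have 1: "- ((T x + a *\<^sub>R u) \<bullet> (y - z)) \<le> e * (norm (y - x) + e * a)"
    using \<open>0 < a\<close> by (rule mult_left_le_imp_le)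
  \<comment> \<open>The normal cone settles the sign of the part of \<open>u\<close> along
    \<open>y - x\<close>; only the part along the small vector \<open>x - z\<close> must be
    estimated.\<close>
  have 2: "u \<bullet> (y - x) \<le> 0" using u(1) assms(4) by (simp add: normal_cone_def)
  have "u \<bullet> (x - z) \<le> norm u * norm (x - z)" by (rule norm_cauchy_schwarz)
  also have "\<dots> \<le> M * (e * a)"
    using e u(2) order_trans[OF norm_ge_zero u(2)] by (intro mult_mono) auto
  finally have "u \<bullet> (y - z) \<le> M * (e * a)" using 2 by (simp add: inner_simps)
  then have 3: "a * (u \<bullet> (y - z)) \<le> a * (M * (e * a))" using \<open>0 < a\<close> by simp
  have "T x \<bullet> (x - z) \<le> norm (T x) * norm (x - z)" by (rule norm_cauchy_schwarz)
  also have "\<dots> \<le> norm (T x) * (e * a)" using e by (intro mult_left_mono) auto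
  finally have 4: "T x \<bullet> (x - z) \<le> norm (T x) * (e * a)" .
  have "T x \<bullet> (y - x) = (T x + a *\<^sub>R u) \<bullet> (y - z) - a * (u \<bullet> (y - z)) - T x \<bullet> (x - z)"
    by (simp add: inner_simps algebra_simps)
  then show ?thesis using 1 3 4 by (simp add: algebra_simps)
qed

section \<open>Runs of Variant B.3\<close>

text \<open>The choices made at each iteration are fixed as sequences, so that their asymptotics can
  be stated.\<close>

locale variant_B3_run =
  fixes T :: "'a::euclidean_space \<Rightarrow> 'a" and C :: "'a set" and \<sigma> \<delta> \<theta> M :: real
    and x u z v :: "nat \<Rightarrow> 'a" and \<alpha> :: "nat \<Rightarrow> real"
  assumes closed: "closed C" and convex: "convex C"
    and \<sigma>: "0 < \<sigma>" and \<delta>: "0 < \<delta>" "\<delta> < 1" and \<theta>: "0 < \<theta>" "\<theta> < 1" and M: "0 < M"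
    and cont: "continuous_on C T"
    and nonempty: "vi_solutions T C \<noteq> {}"
    and subset: "vi_solutions T C \<subseteq> dual_vi_solutions T C"
    and x0: "x 0 \<in> C"
    and u: "u k \<in> normal_cone C (x k)" "norm (u k) \<le> M"
    and linesearch: "linesearch_B T C \<delta> \<theta> M (x k) (u k) \<sigma> (\<alpha> k) (z k) (v k)"
    and update: "x (Suc k) = variant_B3 T C (x 0) (x k) (z k) (\<alpha> k *\<^sub>R v k)"
begin

abbreviation "S \<equiv> vi_solutions T C"
abbreviation "p \<equiv> closest_point S (x 0)"
abbreviation "Q k \<equiv> C \<inter> H_set T (z k) (\<alpha> k *\<^sub>R v k) \<inter> W_set (x 0) (x k)"

lemmas ls = linesearch_B_output[OF linesearch \<sigma> \<theta>]

text \<open>The missing inclusion is Minty's lemma. The dual form gives closedness and convexity,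
  and an inequality at every \<open>z k\<close>.\<close>

lemma S_eq: "S = dual_vi_solutions T C"
  using subset dual_vi_solutions_subset[OF convex cont] by blast

lemma closed_S: "closed S" and convex_S: "convex S"
  using closed_convex_dual_vi_solutions[OF closed convex] by (simp_all add: S_eq)

lemma S_subset_C: "S \<subseteq> C"
  by (auto simp: vi_solutions_def)

lemma p_in_S: "p \<in> S"
  by (rule closest_point_in_set[OF closed_S nonempty])

lemma closed_Q: "closed (Q k)" and convex_Q: "convex (Q k)"
  by (intro closed_Int closed closed_convex_H_set closed_convex_W_set)
    (intro convex_Int convex closed_convex_H_set closed_convex_W_set)

lemma update': "x (Suc k) = closest_point (Q k) (x 0)"
  by (simp add: update variant_B3_def)

section \<open>Solutions survive every cut\<close>

text \<open>Add the dual inequality at \<open>z k\<close> to the normal cone inequality of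
  \<open>v k\<close> scaled by \<open>\<alpha> k > 0\<close>. The assumption is discharged in the
  induction that follows.\<close>

lemma S_subset_H:
  assumes "x k \<in> C"
  shows "S \<subseteq> H_set T (z k) (\<alpha> k *\<^sub>R v k)"
proof
  fix s assume s: "s \<in> S"
  have zC: "z k \<in> C" using ls(3) trial_point_in[OF closed assms] by metis
  have "T (z k) \<bullet> (z k - s) \<ge> 0" using s zC by (simp add: S_eq dual_vi_solutions_def)
  moreover have "v k \<bullet> (s - z k) \<le> 0" using ls(4)[of k] s S_subset_C
    by (auto simp: normal_cone_def)
  then have "\<alpha> k * (v k \<bullet> (s - z k)) \<le> 0" using ls(1)[of k] by (simp add: mult_le_0_iff)
  ultimately show "s \<in> H_set T (z k) (\<alpha> k *\<^sub>R v k)"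
    by (simp add: H_set_def inner_simps algebra_simps)
qed

text \<open>A joint induction: solutions make \<open>Q k\<close> nonempty, so its projection really
  lies in it, and the obtuse-angle inequality there says exactly that solutions belong to the next
  \<open>W_set\<close>.\<close>

lemma x_in_C: "x k \<in> C" and S_subset_W: "S \<subseteq> W_set (x 0) (x k)"
proof -
  have "x k \<in> C \<and> S \<subseteq> W_set (x 0) (x k)"
  proof (induction k)
    case 0
    \<comment> \<open>For \<open>k = 0\<close> the normal vector of \<open>W_set\<close> vanishes
      and the set is the whole space.\<close>
    then show ?case using x0 by (auto simp: W_set_def)
  next
    case (Suc k)
    then have sub: "S \<subseteq> Q k" using S_subset_H S_subset_C by blast
    then have "x (Suc k) \<in> Q k"
      unfolding update' using nonempty by (intro closest_point_in_set closed_Q) auto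
    moreover have "S \<subseteq> W_set (x 0) (x (Suc k))"
    proof
      fix s assume "s \<in> S"
      then have "(x 0 - x (Suc k)) \<bullet> (s - x (Suc k)) \<le> 0"
        unfolding update' using sub by (intro closest_point_dot[OF convex_Q closed_Q]) auto
      then show "s \<in> W_set (x 0) (x (Suc k))" by (simp add: W_set_def inner_commute)
    qed
    ultimately show ?case by blast
  qed
  then show "x k \<in> C" "S \<subseteq> W_set (x 0) (x k)" by auto
qed

lemma S_subset_Q: "S \<subseteq> Q k"
  using S_subset_H[OF x_in_C] S_subset_W S_subset_C by blast

lemma x_Suc_in_Q: "x (Suc k) \<in> Q k"
  unfolding update' using S_subset_Q nonempty by (intro closest_point_in_set closed_Q) blast

section \<open>Distances to the starting point\<close>

text \<open>A later iterate is nearest to \<open>x 0\<close> in a set \<open>Q j\<close> that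
  contains \<open>p\<close>.\<close>

lemma dist_le: "norm (x k - x 0) \<le> norm (p - x 0)"
proof (cases k)
  case (Suc j)
  have "dist (x 0) (x k) \<le> dist (x 0) p" unfolding Suc update'
    using S_subset_Q p_in_S by (intro closest_point_le closed_Q) blast
  then show ?thesis by (simp add: dist_norm norm_minus_commute)
qed simp

text \<open>A Pythagorean inequality: membership in \<open>W_set\<close> makes the angle at
  \<open>x k\<close> non-acute.\<close>

lemma dist_increasing:
  "(norm (x k - x 0))\<^sup>2 + (norm (x (Suc k) - x k))\<^sup>2 \<le> (norm (x (Suc k) - x 0))\<^sup>2"
proof -
  have "(x (Suc k) - x k) \<bullet> (x 0 - x k) \<le> 0"
    using x_Suc_in_Q by (simp add: W_set_def)
  then show ?thesis
    by (simp add: power2_norm_eq_inner inner_diff_left inner_diff_right inner_commute)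
qed

text \<open>The squared distances increase and are bounded, so their increments, which dominate the
  squared steps, vanish.\<close>

lemma step_tendsto_0: "(\<lambda>k. norm (x (Suc k) - x k)) \<longlonglongrightarrow> 0"
proof -
  define d where "d k = (norm (x k - x 0))\<^sup>2" for k
  have step: "(norm (x (Suc k) - x k))\<^sup>2 \<le> d (Suc k) - d k" for k
    using dist_increasing[of k] by (simp add: d_def)
  have "incseq d"
  proof (rule incseq_SucI)
    show "d k \<le> d (Suc k)" for k using step[of k] by (smt (verit) zero_le_power2)
  qed
  moreover have "d k \<le> (norm (p - x 0))\<^sup>2" for k
    unfolding d_def using dist_le by (intro power_mono) auto
  ultimately obtain L where L: "d \<longlonglongrightarrow> L" by (meson incseq_convergent)
  have "(\<lambda>k. d (Suc k) - d k) \<longlonglongrightarrow> L - L"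
    by (intro tendsto_diff LIMSEQ_Suc L)
  then have "(\<lambda>k. d (Suc k) - d k) \<longlonglongrightarrow> 0" by simp
  then have "(\<lambda>k. (norm (x (Suc k) - x k))\<^sup>2) \<longlonglongrightarrow> 0"
    by (rule tendsto_sandwich[OF _ _ tendsto_const, rotated 2]) (auto simp: step)
  then show ?thesis
    using tendsto_real_sqrt[of _ 0] by fastforce
qed

section \<open>Compactness and the vanishing gap\<close>

text \<open>Provides one compact region for all iterates and trial points, for bounding
  \<open>T\<close> and for uniform continuity, and a displacement bound linear in the trial
  value.\<close>

lemma trial_points_bounded:
  obtains B R where "0 < B" "\<And>k. norm (T (x k)) \<le> B"
    "\<And>k. x k \<in> C \<inter> cball (x 0) R"
    "\<And>k a. 0 \<le> a \<Longrightarrow> a \<le> \<sigma> \<Longrightarrow> norm (trial_point T C (x k) (u k) a - x k) \<le> a * B"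
    "\<And>k a. 0 \<le> a \<Longrightarrow> a \<le> \<sigma> \<Longrightarrow> trial_point T C (x k) (u k) a \<in> C \<inter> cball (x 0) R"
proof -
  define r where "r = norm (p - x 0)"
  have "compact (C \<inter> cball (x 0) r)" using closed by (simp add: closed_Int_compact)
  then have "bounded (T ` (C \<inter> cball (x 0) r))"
    by (intro compact_imp_bounded compact_continuous_image continuous_on_subset[OF cont]) auto
  then obtain A where A: "\<And>y. y \<in> C \<inter> cball (x 0) r \<Longrightarrow> norm (T y) \<le> A" "0 < A"
    unfolding bounded_pos by (metis image_eqI)
  have xr: "x k \<in> C \<inter> cball (x 0) r" for k
    using dist_le[of k] x_in_C by (simp add: r_def dist_norm norm_minus_commute)
  \<comment> \<open>\<open>A\<close> bounds \<open>T\<close> at the iterates and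
    \<open>\<sigma> * M\<close> bounds the scaled normal vectors.\<close>
  define B where "B = A + \<sigma> * M"
  have AB: "A \<le> B" "0 < B" using \<sigma> \<theta> M A(2) by (auto simp: B_def add_pos_pos)
  have disp: "norm (trial_point T C (x k) (u k) a - x k) \<le> a * B"
    if a: "0 \<le> a" "a \<le> \<sigma>" for k a
  proof -
    have "norm (T (x k) + a *\<^sub>R u k) \<le> norm (T (x k)) + a * norm (u k)"
      using norm_triangle_ineq[of "T (x k)" "a *\<^sub>R u k"] a(1) by simp
    also have "\<dots> \<le> A + \<sigma> * M"
      using A(1)[OF xr] a u(2)[of k] \<sigma> \<theta> by (intro add_mono mult_mono) auto
    finally have "a * norm (T (x k) + a *\<^sub>R u k) \<le> a * B"
      unfolding B_def using a(1) by (intro mult_left_mono) auto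
    then show ?thesis
      using trial_point_displacement[OF closed convex x_in_C a(1)] order_trans by blast
  qed
  have "trial_point T C (x k) (u k) a \<in> C \<inter> cball (x 0) (r + \<sigma> * B)"
    if a: "0 \<le> a" "a \<le> \<sigma>" for k a
  proof -
    have "a * B \<le> \<sigma> * B" using a AB by (intro mult_right_mono) auto
    then have "dist (x k) (trial_point T C (x k) (u k) a) \<le> \<sigma> * B"
      using disp[OF a, of k] by (simp add: dist_norm norm_minus_commute)
    moreover have "dist (x 0) (x k) \<le> r" using xr[of k] by simp
    ultimately have "dist (x 0) (trial_point T C (x k) (u k) a) \<le> r + \<sigma> * B"
      using dist_triangle[of "x 0" "trial_point T C (x k) (u k) a" "x k"] by linarith
    then show ?thesis using trial_point_in[OF closed x_in_C] by simp
  qed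
  moreover have "x k \<in> C \<inter> cball (x 0) (r + \<sigma> * B)" for k
    using xr[of k] \<sigma> \<theta> AB by (auto simp: add_increasing2)
  moreover have "norm (T (x k)) \<le> B" for k
    using A(1)[OF xr, of k] AB(1) by linarith
  ultimately show ?thesis using that[OF AB(2)] disp by blast
qed

text \<open>Since \<open>x (Suc k)\<close> lies in the halfspace, the separation of
  \<open>x k\<close> from it is paid for by the step, so the squared gap is at most a constant times
  the step length.\<close>

lemma gap_tendsto_0: "(\<lambda>k. norm (x k - z k)) \<longlonglongrightarrow> 0"
proof -
  obtain B R where B: "0 < B" "\<And>k. norm (T (x k)) \<le> B"
    and R: "\<And>k a. 0 \<le> a \<Longrightarrow> a \<le> \<sigma> \<Longrightarrow> trial_point T C (x k) (u k) a \<in> C \<inter> cball (x 0) R"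
    by (rule trial_points_bounded) blast
  have "compact (C \<inter> cball (x 0) R)" using closed by (simp add: closed_Int_compact)
  then have "bounded (T ` (C \<inter> cball (x 0) R))"
    by (intro compact_imp_bounded compact_continuous_image continuous_on_subset[OF cont]) auto
  then obtain A where A: "\<And>y. y \<in> C \<inter> cball (x 0) R \<Longrightarrow> norm (T y) \<le> A" "0 < A"
    unfolding bounded_pos by (metis image_eqI)
  define D where "D = A + \<sigma> * M"
  have bound: "(1 - \<delta>) * (norm (x k - z k))\<^sup>2 \<le> \<sigma> * (D * norm (x (Suc k) - x k))" for k
  proof -
    let ?w = "T (z k) + \<alpha> k *\<^sub>R v k"
    note a = ls(1)[of k] ls(2)[of k]
    have "z k \<in> C \<inter> cball (x 0) R"
      using R[of "\<alpha> k" k] ls(3)[of k] a by simp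
    from A(1)[OF this] have "norm ?w \<le> D"
      using norm_triangle_ineq[of "T (z k)" "\<alpha> k *\<^sub>R v k"]
        mult_mono[of "\<alpha> k" \<sigma> "norm (v k)" M] a ls(5)[of k] \<sigma>
      by (simp add: D_def)
    then have D: "norm ?w * norm (x k - x (Suc k)) \<le> D * norm (x (Suc k) - x k)"
      by (simp add: norm_minus_commute mult_right_mono)
    have "?w \<bullet> (x (Suc k) - z k) \<le> 0"
      using x_Suc_in_Q[of k] by (simp add: H_set_def)
    then have "?w \<bullet> (x k - z k) \<le> ?w \<bullet> (x k - x (Suc k))"
      by (simp add: inner_diff_right)
    also have "\<dots> \<le> norm ?w * norm (x k - x (Suc k))" by (rule norm_cauchy_schwarz)
    finally have le: "?w \<bullet> (x k - z k) \<le> D * norm (x (Suc k) - x k)" using D by linarith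
    have "(1 - \<delta>) * (norm (x k - z k))\<^sup>2 \<le> \<alpha> k * (?w \<bullet> (x k - z k))"
      by (rule accepted_trial_separates[OF closed convex x_in_C less_imp_le ls(3) ls(6)]) (rule a)
    also have "\<dots> \<le> \<alpha> k * (D * norm (x (Suc k) - x k))"
      using a le by (intro mult_left_mono) auto
    also have "\<dots> \<le> \<sigma> * (D * norm (x (Suc k) - x k))"
      using a A(2) \<sigma> M by (intro mult_right_mono) (auto simp: D_def)
    finally show ?thesis .
  qed
  have "(\<lambda>k. \<sigma> * (D * norm (x (Suc k) - x k)) / (1 - \<delta>)) \<longlonglongrightarrow> \<sigma> * (D * 0) / (1 - \<delta>)"
    using \<delta> by (intro tendsto_intros step_tendsto_0) auto
  then have lim: "(\<lambda>k. \<sigma> * (D * norm (x (Suc k) - x k)) / (1 - \<delta>)) \<longlonglongrightarrow> 0" by simp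
  have le: "(norm (x k - z k))\<^sup>2 \<le> \<sigma> * (D * norm (x (Suc k) - x k)) / (1 - \<delta>)" for k
    using bound[of k] \<delta> by (simp add: pos_le_divide_eq mult.commute)
  have "(\<lambda>k. (norm (x k - z k))\<^sup>2) \<longlonglongrightarrow> 0"
    by (rule tendsto_sandwich[OF _ _ tendsto_const lim]) (simp_all add: le)
  then show ?thesis
    using tendsto_real_sqrt[of _ 0] by fastforce
qed

text \<open>
  The accepted trial serves as witness when \<open>\<alpha> k\<close> is not small, and the last rejected one
  otherwise: there the failed test bounds the relative displacement by the oscillation of \<open>T\<close>.
\<close>
lemma eventually_small_relative_displacement:
  assumes e: "0 < e"
  shows "\<forall>\<^sub>F k in sequentially. \<exists>a. 0 < a \<and> a \<le> \<sigma> \<and>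
    norm (x k - trial_point T C (x k) (u k) a) \<le> e * a"
proof -
  obtain B R where B: "0 < B" and xR: "\<And>k. x k \<in> C \<inter> cball (x 0) R"
    and disp: "\<And>k a. 0 \<le> a \<Longrightarrow> a \<le> \<sigma> \<Longrightarrow> norm (trial_point T C (x k) (u k) a - x k) \<le> a * B"
    and R: "\<And>k a. 0 \<le> a \<Longrightarrow> a \<le> \<sigma> \<Longrightarrow> trial_point T C (x k) (u k) a \<in> C \<inter> cball (x 0) R"
    by (rule trial_points_bounded) blast
  have "uniformly_continuous_on (C \<inter> cball (x 0) R) T"
    using closed by (intro compact_uniformly_continuous continuous_on_subset[OF cont])
      (auto simp: closed_Int_compact)
  moreover have "0 < \<delta> * e / 2" using e \<delta> by simp
  ultimately obtain \<eta> where \<eta>: "0 < \<eta>"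
    "\<And>y y'. y \<in> C \<inter> cball (x 0) R \<Longrightarrow> y' \<in> C \<inter> cball (x 0) R \<Longrightarrow> dist y' y < \<eta> \<Longrightarrow>
      dist (T y') (T y) < \<delta> * e / 2"
    unfolding uniformly_continuous_on_def by metis
  \<comment> \<open>Below \<open>b\<close>, the first entry puts the trial point within
    \<open>\<eta>\<close> of \<open>x k\<close>; the second keeps the two normal vector terms below
    \<open>\<delta> * e / 4\<close> each, leaving half of \<open>\<delta> * e\<close> for the
    oscillation of \<open>T\<close>.\<close>
  define b where "b = min (\<eta> / B) (\<delta> * e / (4 * M))"
  have b: "0 < b" using \<eta>(1) B e \<delta> M by (simp add: b_def)
  \<comment> \<open>If \<open>\<alpha> k < a0\<close>, the first trial was rejected and the
    predecessor \<open>\<alpha> k / \<theta>\<close> is below \<open>b\<close>.\<close>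
  define a0 where "a0 = min \<sigma> (\<theta> * b)"
  have a0: "0 < a0" using b \<sigma> \<theta> by (simp add: a0_def)
  have "\<forall>\<^sub>F k in sequentially. norm (x k - z k) < e * a0"
    using order_tendstoD(2)[OF gap_tendsto_0, of "e * a0"] e a0 by simp
  then show ?thesis
  proof eventually_elim
    case (elim k)
    show ?case
    proof (cases "a0 \<le> \<alpha> k")
      case True
      then have "e * a0 \<le> e * \<alpha> k" using e by simp
      then have "norm (x k - trial_point T C (x k) (u k) (\<alpha> k)) \<le> e * \<alpha> k"
        using elim ls(3)[of k] by simp
      then show ?thesis using ls(1)[of k] ls(2)[of k] by fastforce
    next
      case False
      then have small: "\<alpha> k < \<sigma>" "\<alpha> k < \<theta> * b" by (auto simp: a0_def)
      define a where "a = \<alpha> k / \<theta>"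
      define y where "y = trial_point T C (x k) (u k) a"
      obtain w where a: "a \<le> \<sigma>" and w: "norm w \<le> M"
        and rej: "\<delta> * norm (y - x k) < a * norm (T y - T (x k) + a *\<^sub>R w - a *\<^sub>R u k)"
        using ls(7)[of k] small(1) by (auto simp: a_def y_def)
      have a_pos: "0 < a" using ls(1)[of k] \<theta> by (simp add: a_def)
      have "a < b" using small(2) \<theta> by (simp add: a_def divide_less_eq mult.commute)
      then have ab: "a * B < \<eta>" "4 * (a * M) < \<delta> * e"
        using B M by (auto simp: b_def less_divide_eq mult_ac)
      have aL: "0 \<le> a" "a \<le> \<sigma>" using a a_pos by auto
      have "dist y (x k) < \<eta>"
        using disp[OF aL, of k] ab(1) by (simp add: y_def dist_norm)
      then have "norm (T y - T (x k)) < \<delta> * e / 2"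
        using \<eta>(2)[OF xR R[OF aL]] by (simp add: y_def dist_norm)
      moreover have "norm (T y - T (x k) + a *\<^sub>R w - a *\<^sub>R u k)
          \<le> norm (T y - T (x k)) + a * norm w + a * norm (u k)"
        using norm_triangle_ineq4[of "T y - T (x k) + a *\<^sub>R w" "a *\<^sub>R u k"]
          norm_triangle_ineq[of "T y - T (x k)" "a *\<^sub>R w"] a_pos by simp
      moreover have "a * norm w \<le> a * M" "a * norm (u k) \<le> a * M"
        using w u(2)[of k] a_pos by auto
      ultimately have "norm (T y - T (x k) + a *\<^sub>R w - a *\<^sub>R u k) \<le> \<delta> * e"
        using ab(2) by linarith
      then have "a * norm (T y - T (x k) + a *\<^sub>R w - a *\<^sub>R u k) \<le> a * (\<delta> * e)"
        using a_pos by simp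
      with rej have "\<delta> * norm (y - x k) \<le> \<delta> * (e * a)" by (simp add: mult_ac)
      then have "norm (x k - y) \<le> e * a" using \<delta> by (simp add: norm_minus_commute)
      then show ?thesis using a_pos aL unfolding y_def by blast
    qed
  qed
qed

section \<open>Cluster points and the limit\<close>

lemma eventually_near_solution:
  assumes "y \<in> C" "0 < \<epsilon>"
  shows "\<forall>\<^sub>F k in sequentially. - \<epsilon> \<le> T (x k) \<bullet> (y - x k)"
proof -
  obtain B R where B: "0 < B" "\<And>k. norm (T (x k)) \<le> B" and xR: "\<And>k. x k \<in> C \<inter> cball (x 0) R"
    by (rule trial_points_bounded) blast
  \<comment> \<open>\<open>D\<close> dominates the bracket in
    \<open>trial_point_near_solution\<close> uniformly in \<open>k\<close> and in trial values up to
    \<open>\<sigma>\<close>; the cap \<open>e \<le> 1\<close> below serves the summand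
    \<open>\<sigma>\<close>.\<close>
  define D where "D = dist (x 0) y + R + \<sigma> + \<sigma> * B + \<sigma> * \<sigma> * M"
  have "0 \<le> R" using xR[of 0] by simp
  then have D: "0 < D" using \<sigma> B M by (simp add: D_def add_nonneg_pos add_pos_pos)
  define e where "e = min 1 (\<epsilon> / D)"
  have e: "0 < e" "e \<le> 1" using assms D by (simp_all add: e_def)
  have "e \<le> \<epsilon> / D" by (simp add: e_def)
  then have eD: "e * D \<le> \<epsilon>" using D by (simp add: pos_le_divide_eq)
  show ?thesis
    using eventually_small_relative_displacement[OF e(1)]
  proof eventually_elim
    case (elim k)
    then obtain a where a: "0 < a" "a \<le> \<sigma>"
      and le: "norm (x k - trial_point T C (x k) (u k) a) \<le> e * a" by auto
    have "norm (y - x k) \<le> dist (x 0) y + R"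
      using dist_triangle[of y "x k" "x 0"] xR[of k] by (simp add: dist_norm norm_minus_commute)
    moreover have "a * e \<le> \<sigma> * 1" "a * norm (T (x k)) \<le> \<sigma> * B"
      using a e B(2)[of k] by (intro mult_mono; simp)+
    moreover have "a * a * M \<le> \<sigma> * \<sigma> * M"
      using a M by (intro mult_right_mono mult_mono) auto
    ultimately have "norm (y - x k) + a * e + a * norm (T (x k)) + a * a * M \<le> D"
      by (simp add: D_def)
    then have "e * (norm (y - x k) + a * e + a * norm (T (x k)) + a * a * M) \<le> e * D"
      using e(1) by simp
    then show ?case
      using trial_point_near_solution[OF closed convex x_in_C assms(1) a(1) u refl le] eD
      by linarith
  qed
qed

text \<open>For each fixed \<open>y\<close>, let the subsequence converge first and only then send
  \<open>\<epsilon>\<close> to zero.\<close>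

lemma subseq_limit_in_S:
  assumes r: "strict_mono r" and l: "(x \<circ> r) \<longlonglongrightarrow> l"
  shows "l \<in> S"
proof -
  have lC: "l \<in> C" using closed_sequentially[OF closed _ l] x_in_C by simp
  have Tl: "(\<lambda>n. T ((x \<circ> r) n)) \<longlonglongrightarrow> T l"
    using continuous_on_tendsto_compose[OF cont l lC] x_in_C by simp
  have "0 \<le> T l \<bullet> (y - l)" if y: "y \<in> C" for y
  proof -
    have lim: "(\<lambda>n. T ((x \<circ> r) n) \<bullet> (y - (x \<circ> r) n)) \<longlonglongrightarrow> T l \<bullet> (y - l)"
      by (intro tendsto_intros Tl l)
    have lower: "- \<epsilon> \<le> T l \<bullet> (y - l)" if "0 < \<epsilon>" for \<epsilon>
    proof (rule tendsto_lowerbound[OF lim])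
      show "\<forall>\<^sub>F n in sequentially. - \<epsilon> \<le> T ((x \<circ> r) n) \<bullet> (y - (x \<circ> r) n)"
        using eventually_subseq[OF r eventually_near_solution[OF y that]] by simp
    qed simp
    show ?thesis
    proof (rule field_le_epsilon)
      show "0 \<le> T l \<bullet> (y - l) + \<epsilon>" if "0 < \<epsilon>" for \<epsilon>
        using lower[OF that] by linarith
    qed
  qed
  with lC show ?thesis by (simp add: vi_solutions_def)
qed

theorem x_tendsto_projection: "x \<longlonglongrightarrow> p"
proof (rule tendsto_of_unique_subseq_limit)
  show "compact (cball (x 0) (norm (p - x 0)))" by simp
  show "x k \<in> cball (x 0) (norm (p - x 0))" for k
    using dist_le[of k] by (simp add: dist_norm norm_minus_commute)
  fix r l assume r: "strict_mono r" and l: "(x \<circ> r) \<longlonglongrightarrow> l"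
  have "(\<lambda>n. dist (x 0) ((x \<circ> r) n)) \<longlonglongrightarrow> dist (x 0) l" by (intro tendsto_intros l)
  moreover have "dist (x 0) ((x \<circ> r) n) \<le> dist (x 0) p" for n
    using dist_le[of "r n"] by (simp add: dist_norm norm_minus_commute)
  ultimately have "dist (x 0) l \<le> dist (x 0) p" by (intro LIMSEQ_le_const2) auto
  then show "l = p"
    \<comment> \<open>By convexity every point of \<open>S\<close> other than \<open>p\<close> is
      strictly farther from \<open>x 0\<close>.\<close>
    using closest_point_lt[OF convex_S closed_S subseq_limit_in_S[OF r l], of "x 0"] by force
qed

end

theorem theorem3p13:
  fixes T :: "real ^ 'n \<Rightarrow> real ^ 'n"
    and domT C :: "(real ^ 'n) set"
    and \<sigma> \<delta> \<theta> M :: real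
    and x :: "nat \<Rightarrow> real ^ 'n"
  assumes "C \<subseteq> domT" and "C \<noteq> {}" and "closed C" and "convex C"
    and "\<sigma> > 0" and "0 < \<delta>" and "\<delta> < 1" and "0 < \<theta>" and "\<theta> < 1" and "M > 0"
    and "continuous_on C T"
    and "vi_solutions T C \<noteq> {}"
    and "vi_solutions T C \<subseteq> dual_vi_solutions T C"
    and "generated_by_B T C \<sigma> \<delta> \<theta> M (variant_B3 T C) x"
    and "\<And>k. x k \<notin> vi_solutions T C"
  shows "x \<longlonglongrightarrow> closest_point (vi_solutions T C) (x 0)"
proof -
  obtain u \<alpha> z v where x0: "x 0 \<in> C"
    and "\<And>k. u k \<in> normal_cone C (x k) \<and> norm (u k) \<le> M \<and>
      linesearch_B T C \<delta> \<theta> M (x k) (u k) \<sigma> (\<alpha> k) (z k) (v k) \<and>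
      x (Suc k) = variant_B3 T C (x 0) (x k) (z k) (\<alpha> k *\<^sub>R v k)"
    using assms(14) unfolding generated_by_B_def by metis
  then interpret variant_B3_run T C \<sigma> \<delta> \<theta> M x u z v \<alpha>
    using assms by unfold_locales auto
  show ?thesis by (rule x_tendsto_projection)
qed

end
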